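(* Let $NA(n,k)=\frac{1}{k+1}\binom{n+1}{k}\binom{n}{k}$ and $NB(n,k)=\binom{n}{k}^2$. Then the infinite matrices $$N_A^{\square}=[NA(n+k,k)]_{n,k\geq 0}\quad\text{and}\quad N_B^{\square}=[NB(n+k,k)]_{n,k\geq 0}$$ are strictly totally positive.
   Context: A (finite or infinite) real matrix is strictly totally positive (STP) if all of its minors are positive. *)

theory Defs
  imports Complex_Main "Jordan_Normal_Form.Determinant"
begin

text \<open>An infinite real matrix, with rows and columns indexed from \<open>0\<close>, is a function
  \<^typ>\<open>nat \<Rightarrow> nat \<Rightarrow> real\<close>. Its minor of order \<open>r\<close> with rows \<open>i 0 < \<dots> < i (r - 1)\<close> and
  columns \<open>j 0 < \<dots> < j (r - 1)\<close> only depends on \<open>i\<close> and \<open>j\<close> below \<open>r\<close>.\<close>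

definition minor :: "(nat \<Rightarrow> nat \<Rightarrow> real) \<Rightarrow> nat \<Rightarrow> (nat \<Rightarrow> nat) \<Rightarrow> (nat \<Rightarrow> nat) \<Rightarrow> real" where
  "minor M r i j = det (mat r r (\<lambda>(a, b). M (i a) (j b)))"

definition strictly_totally_positive :: "(nat \<Rightarrow> nat \<Rightarrow> real) \<Rightarrow> bool" where
  "strictly_totally_positive M \<longleftrightarrow>
    (\<forall>r \<ge> 1. \<forall>i j. strict_mono_on {..<r} i \<longrightarrow> strict_mono_on {..<r} j \<longrightarrow> minor M r i j > 0)"

definition NA :: "nat \<Rightarrow> nat \<Rightarrow> real" where
  "NA n k = 1 / (real k + 1) * real ((n + 1) choose k) * real (n choose k)"

definition NB :: "nat \<Rightarrow> nat \<Rightarrow> real" where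
  "NB n k = (real (n choose k))\<^sup>2"

definition NA_square :: "nat \<Rightarrow> nat \<Rightarrow> real" where
  "NA_square n k = NA (n + k) k"

definition NB_square :: "nat \<Rightarrow> nat \<Rightarrow> real" where
  "NB_square n k = NB (n + k) k"

end

theory Submission
  imports Defs
begin

text \<open>Up to positive row and column factors, both matrices are Hankel matrices with entries
  \<open>(n + k)! (n + k + c)!\<close>, where \<open>c = 1\<close> for type A and \<open>c = 0\<close> for type B. By Fekete's criterion
  only contiguous minors matter, and these are determinants of matrices \<open>(m + p + q)! (m' + p + q)!\<close>.
  Vandermonde's convolution writes \<open>(m + p + q)!\<close> as \<open>\<Sum>l. d l * B p l * B q l\<close> with \<open>d > 0\<close> and
  \<open>B\<close> lower triangular with positive diagonal, so the entrywise product of two such matrices is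
  positive definite, hence has positive determinant.\<close>

section \<open>Minors under transposition and under row and column scaling\<close>

lemma minor_cong:
  assumes "\<And>a. a < r \<Longrightarrow> i a = i' a" "\<And>a. a < r \<Longrightarrow> j a = j' a"
  shows "minor M r i j = minor M r i' j'"
  unfolding minor_def by (rule arg_cong[where f = det], rule eq_matI) (use assms in auto)

lemma minor_transpose: "minor (\<lambda>a b. M b a) r j i = minor M r i j"
proof -
  have "mat r r (\<lambda>(a, b). M (i b) (j a)) = transpose_mat (mat r r (\<lambda>(a, b). M (i a) (j b)))"
    by (rule eq_matI) auto
  then show ?thesis
    unfolding minor_def by (simp add: det_transpose[where n = r])
qed

text \<open>Each Leibniz term contains every row factor and every column factor exactly
  once.\<close>

lemma minor_scale:
  "minor (\<lambda>a b. f a * M a b * g b) r i j = (\<Prod>a<r. f (i a)) * (\<Prod>a<r. g (j a)) * minor M r i j"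
proof -
  have "(\<Prod>a = 0..<r. f (i a) * M (i a) (j (p a)) * g (j (p a)))
      = (\<Prod>a<r. f (i a)) * (\<Prod>a<r. g (j a)) * (\<Prod>a = 0..<r. M (i a) (j (p a)))"
    if "p permutes {0..<r}" for p
    using prod.permute[OF that, of "\<lambda>a. g (j a)"]
    by (simp add: prod.distrib atLeast0LessThan comp_def mult_ac)
  then show ?thesis
    unfolding minor_def det_def
    by (auto simp: sum_distrib_left permutes_in_image intro!: sum.cong prod.cong)
qed

lemma strictly_totally_positive_scale:
  assumes "strictly_totally_positive M" "\<And>a. f a > 0" "\<And>b. g b > 0"
  shows "strictly_totally_positive (\<lambda>a b. f a * M a b * g b)"
  using assms unfolding strictly_totally_positive_def minor_scale by (auto intro!: prod_pos mult_pos_pos)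

section \<open>Laplace expansion and a three-term identity for minors\<close>

definition skip :: "nat \<Rightarrow> nat \<Rightarrow> nat" where
  "skip t a = (if a < t then a else Suc a)"

text \<open>On index sequences \<open>skip\<close> deletes and \<open>ins\<close> inserts:
  \<open>ins k x q (skip k a) = q a\<close>.\<close>

definition ins :: "nat \<Rightarrow> 'a \<Rightarrow> (nat \<Rightarrow> 'a) \<Rightarrow> nat \<Rightarrow> 'a" where
  "ins k x q a = (if a < k then q a else if a = k then x else q (a - 1))"

text \<open>Laplace expansion along the inserted row. The sum is linear in row \<open>x\<close> of
  \<open>M\<close> and free of \<open>k\<close>, so moving that row only changes the sign.\<close>

lemma minor_ins_row:
  assumes "k \<le> n"
  shows "minor M (Suc n) (ins k x q) j
    = (- 1) ^ k * (\<Sum>b\<le>n. (- 1) ^ b * M x (j b) * minor M n q (\<lambda>a. j (skip b a)))"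
proof -
  let ?A = "mat (Suc n) (Suc n) (\<lambda>(a, b). M (ins k x q a) (j b))"
  have del: "mat_delete ?A k b = mat n n (\<lambda>(a, c). M (q a) (j (skip b c)))" if "b \<le> n" for b
    using assms that by (intro eq_matI) (auto simp: mat_delete_def ins_def skip_def)
  have term_eq: "?A $$ (k, b) * cofactor ?A k b
      = (- 1) ^ k * ((- 1) ^ b * M x (j b) * minor M n q (\<lambda>a. j (skip b a)))" if "b \<le> n" for b
  proof -
    have "?A $$ (k, b) = M x (j b)"
      using assms that by (simp add: ins_def)
    then show ?thesis
      by (simp only: cofactor_def del[OF that] minor_def power_add mult_ac)
  qed
  have "det ?A = (\<Sum>b<Suc n. ?A $$ (k, b) * cofactor ?A k b)"
    by (rule laplace_expansion_row[of _ "Suc n"]) (use assms in auto)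
  also have "\<dots> = (\<Sum>b\<le>n. (- 1) ^ k * ((- 1) ^ b * M x (j b) * minor M n q (\<lambda>a. j (skip b a))))"
    unfolding lessThan_Suc_atMost by (intro sum.cong refl) (rule term_eq, simp)
  finally show ?thesis
    unfolding minor_def by (simp add: sum_distrib_left)
qed

lemma minor_identical_rows:
  assumes "a < r" "b < r" "a \<noteq> b" "i a = i b"
  shows "minor M r i j = 0"
  unfolding minor_def
  by (rule det_identical_rows[of _ r a b]) (use assms in \<open>auto intro!: eq_vecI\<close>)

text \<open>Prepending a copy of column \<open>j b\<close> makes a matrix of order
  \<open>n + 2\<close> singular; expanding along that copy gives the relation.\<close>

lemma minors_linear_relation:
  assumes "b \<le> n"
  shows "(\<Sum>t\<le>Suc n. (- 1) ^ t * M (e t) (j b) * minor M (Suc n) (\<lambda>a. e (skip t a)) j) = 0"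
proof -
  have "minor (\<lambda>a b. M b a) (Suc (Suc n)) (ins 0 (j b) j) e = 0"
    by (rule minor_identical_rows[of 0 _ "Suc b"]) (use assms in \<open>auto simp: ins_def\<close>)
  then show ?thesis
    using minor_ins_row[of 0 "Suc n" "\<lambda>a b. M b a" "j b" j e] by (simp add: minor_transpose[of M])
qed

text \<open>Here \<open>\<psi>\<close> is the linear functional on rows obtained by inserting a row among the rows
  \<open>e 1, \<dots>, e (n + 1)\<close> without \<open>e (p + 1)\<close>. It vanishes on these, so applying it to the linear
  relation between \<open>n + 3\<close> rows restricted to \<open>n + 2\<close> columns leaves three terms.\<close>

lemma minor_three_term:
  fixes e :: "nat \<Rightarrow> nat"
  assumes "p \<le> n"
  defines "q \<equiv> (\<lambda>a. e (Suc (skip p a)))"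
  shows "minor M (n + 2) (\<lambda>a. e (skip (Suc p) a)) j * minor M (Suc n) (\<lambda>a. e (Suc a)) j
    = minor M (n + 2) (\<lambda>a. e (Suc a)) j * minor M (Suc n) (ins 0 (e 0) q) j
      + minor M (n + 2) e j * minor M (Suc n) (ins n (e (n + 2)) q) j"
proof -
  define \<psi> where "\<psi> x = (\<Sum>b\<le>n. (- 1) ^ b * M x (j b) * minor M n q (\<lambda>a. j (skip b a)))" for x
  define V where "V t = minor M (n + 2) (\<lambda>a. e (skip t a)) j" for t
  have \<psi>: "\<psi> x = (- 1) ^ k * minor M (Suc n) (ins k x q) j" if "k \<le> n" for k x
    unfolding minor_ins_row[OF that] \<psi>_def by simp
  have \<psi>_zero: "\<psi> (e t) = 0" if t: "t \<noteq> 0" "t \<noteq> Suc p" "t \<le> Suc n" for t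
  proof -
    have pred: "Suc (Suc (t - Suc (Suc 0))) = t" if "\<not> t \<le> p"
      using that t by arith
    \<comment> \<open>After the inserted row at \<open>0\<close>, \<open>e t\<close> recurs at
      position \<open>t\<close>, or at \<open>t - 1\<close> once the omitted index
      \<open>Suc p\<close> has been passed.\<close>
    have "minor M (Suc n) (ins 0 (e t) q) j = 0"
      by (rule minor_identical_rows[of 0 _ "if t \<le> p then t else t - 1"])
        (use t assms(1) pred in \<open>auto simp: ins_def q_def skip_def\<close>)
    then show ?thesis
      using \<psi>[of 0] by simp
  qed
  have V: "(\<Sum>t\<le>n + 2. (- 1) ^ t * M (e t) (j b) * V t) = 0" if "b \<le> n" for b
    using minors_linear_relation[of b "Suc n" M e j] that by (simp add: V_def del: sum.atMost_Suc)
  have "(\<Sum>t\<le>n + 2. (- 1) ^ t * V t * \<psi> (e t))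
      = (\<Sum>b\<le>n. (- 1) ^ b * minor M n q (\<lambda>a. j (skip b a)) *
          (\<Sum>t\<le>n + 2. (- 1) ^ t * M (e t) (j b) * V t))"
    unfolding \<psi>_def sum_distrib_left by (subst sum.swap) (simp only: mult_ac)
  also have "\<dots> = 0"
    using V by simp
  finally have "0 = (\<Sum>t\<le>n + 2. (- 1) ^ t * V t * \<psi> (e t))" ..
  also have "\<dots> = (\<Sum>t\<in>{0, Suc p, n + 2}. (- 1) ^ t * V t * \<psi> (e t))"
    by (rule sum.mono_neutral_right) (use assms \<psi>_zero in auto)
  also have "\<dots> = V 0 * \<psi> (e 0) + (- 1) ^ Suc p * V (Suc p) * \<psi> (e (Suc p))
      + (- 1) ^ (n + 2) * V (n + 2) * \<psi> (e (n + 2))"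
    using assms by simp
  \<comment> \<open>Inserting at positions \<open>0\<close>, \<open>p\<close> and \<open>n\<close>
    respectively makes the signs combine to 1, -1 and 1.\<close>
  also have "\<dots> = V 0 * minor M (Suc n) (ins 0 (e 0) q) j
      - V (Suc p) * minor M (Suc n) (ins p (e (Suc p)) q) j
      + V (n + 2) * minor M (Suc n) (ins n (e (n + 2)) q) j"
    using \<psi>[of 0 "e 0"] \<psi>[of p "e (Suc p)"] \<psi>[of n "e (n + 2)"] assms
    by (simp flip: power_add mult_2 add: mult_ac power_mult_distrib)
  also have "minor M (Suc n) (ins p (e (Suc p)) q) j = minor M (Suc n) (\<lambda>a. e (Suc a)) j"
    by (rule minor_cong) (auto simp: ins_def q_def skip_def)
  also have "V 0 = minor M (n + 2) (\<lambda>a. e (Suc a)) j"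
    unfolding V_def by (simp add: skip_def)
  also have "V (n + 2) = minor M (n + 2) e j"
    unfolding V_def by (rule minor_cong) (auto simp: skip_def)
  finally show ?thesis
    by (simp add: V_def)
qed

section \<open>Fekete's criterion\<close>

lemma strict_mono_on_lessThan_Suc:
  fixes f :: "nat \<Rightarrow> 'a :: order"
  assumes "\<And>a. Suc a < r \<Longrightarrow> f a < f (Suc a)"
  shows "strict_mono_on {..<r} f"
proof (rule strict_mono_onI)
  fix x y assume "x \<in> {..<r}" "y \<in> {..<r}" "x < y"
  from this(3,2) show "f x < f y"
    by (induction rule: less_Suc_induct) (use assms in \<open>auto intro: less_trans\<close>)
qed

text \<open>Induction on the spread \<open>i (Suc n) - i 0\<close>: the three-term identity
  expresses a minor with a row gap through minors of smaller spread and minors of order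
  \<open>Suc n\<close>.\<close>

lemma minor_pos_of_contiguous_rows:
  assumes small: "\<And>i. strict_mono_on {..<Suc n} i \<Longrightarrow> minor M (Suc n) i j > 0"
    and contiguous: "\<And>m. minor M (n + 2) (\<lambda>a. m + a) j > 0"
    and "strict_mono_on {..<n + 2} i"
  shows "minor M (n + 2) i j > 0"
  using assms(3)
proof (induction "i (Suc n) - i 0" arbitrary: i rule: less_induct)
  case less
  have mono: "i a < i b" if "a < b" "b < n + 2" for a b
    using less.prems that by (auto simp: strict_mono_on_def)
  show ?case
  proof (cases "\<exists>p\<le>n. Suc (i p) < i (Suc p)")
    case False
    have "i 0 + a = i a" if "a < n + 2" for a
      using that
    proof (induction a)
      case (Suc a)
      then have "i a < i (Suc a)" "\<not> Suc (i a) < i (Suc a)"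
        using mono[of a "Suc a"] False by (auto simp: less_Suc_eq_le)
      then show ?case using Suc by simp
    qed simp
    then have "minor M (n + 2) (\<lambda>a. i 0 + a) j = minor M (n + 2) i j"
      by (intro minor_cong) auto
    then show ?thesis using contiguous[of "i 0"] by simp
  next
    case True
    then obtain p where p: "p \<le> n" "Suc (i p) < i (Suc p)" by blast
    \<comment> \<open>Filling a gap of \<open>i\<close> and then dropping either end lowers the spread.\<close>
    define e where "e = ins (Suc p) (Suc (i p)) i"
    define q where "q = (\<lambda>a. e (Suc (skip p a)))"
    have e_Suc: "e a < e (Suc a)" if "a < n + 2" for a
    proof -
      consider "a < p" | "a = p" | "a = Suc p" | "Suc p < a" by linarith
      then show ?thesis
        using that p mono[of "a - 1" a] mono[of a "Suc a"] by cases (auto simp: e_def ins_def)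
    qed
    have "strict_mono_on {..<n + 3} e"
      by (rule strict_mono_on_lessThan_Suc) (use e_Suc in auto)
    then have e: "e a < e b" if "a < b" "b < n + 3" for a b
      using that by (auto simp: strict_mono_on_def)
    have ends: "e 0 = i 0" "e (n + 2) = i (Suc n)"
      using p by (auto simp: e_def ins_def)
    have large_pos: "minor M (n + 2) (\<lambda>a. e (Suc a)) j > 0" "minor M (n + 2) e j > 0"
      by (rule less.hyps; use e[of 0 1] e[of 1 "n + 2"] e[of 0 "n + 1"] e[of "n + 1" "n + 2"] ends
        in \<open>auto intro!: strict_mono_onI e\<close>)+
    have small_pos: "minor M (Suc n) (\<lambda>a. e (Suc a)) j > 0"
      "minor M (Suc n) (ins 0 (e 0) q) j > 0" "minor M (Suc n) (ins n (e (n + 2)) q) j > 0"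
      using p by (auto intro!: small strict_mono_onI e simp: ins_def q_def skip_def)
    \<comment> \<open>Deleting the filler at position \<open>Suc p\<close> recovers
      \<open>i\<close>.\<close>
    have "minor M (n + 2) (\<lambda>a. e (skip (Suc p) a)) j = minor M (n + 2) i j"
      by (rule minor_cong) (auto simp: e_def ins_def skip_def)
    then have "minor M (n + 2) i j * minor M (Suc n) (\<lambda>a. e (Suc a)) j > 0"
      using minor_three_term[OF p(1), of M e j, folded q_def] large_pos small_pos
      by (simp add: add_pos_pos mult_pos_pos)
    then show ?thesis
      using small_pos(1) by (rule zero_less_mult_pos2)
  qed
qed

text \<open>Induction on the order. Row gaps are treated first, over contiguous columns; the
  transposed matrix then handles column gaps over arbitrary rows.\<close>

lemma strictly_totally_positive_of_contiguous_minors: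
  assumes contiguous: "\<And>r m k. minor M (Suc r) (\<lambda>a. m + a) (\<lambda>a. k + a) > 0"
  shows "strictly_totally_positive M"
proof -
  have "minor M (Suc n) i j > 0"
    if "strict_mono_on {..<Suc n} i" "strict_mono_on {..<Suc n} j" for n i j
    using that
  proof (induction n arbitrary: i j)
    case 0
    have "minor M (Suc 0) i j = minor M (Suc 0) (\<lambda>a. i 0 + a) (\<lambda>a. j 0 + a)"
      by (rule minor_cong) auto
    then show ?case using contiguous by simp
  next
    case (Suc n)
    have shift: "strict_mono_on A (\<lambda>a. k + a)" for A and k :: nat
      by (auto intro: strict_mono_onI)
    have cols: "minor M (n + 2) i (\<lambda>a. k + a) > 0" for k
      by (rule minor_pos_of_contiguous_rows)
        (use Suc contiguous[of "Suc n"] shift in auto)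
    have "strict_mono_on {..<Suc n} i"
      using Suc.prems(1) by (auto simp: strict_mono_on_def)
    then have small: "minor (\<lambda>a b. M b a) (Suc n) j' i > 0" if "strict_mono_on {..<Suc n} j'" for j'
      unfolding minor_transpose[of M] using Suc.IH that by blast
    have "minor (\<lambda>a b. M b a) (n + 2) j i > 0"
      by (rule minor_pos_of_contiguous_rows[OF small])
        (use Suc.prems(2) cols in \<open>simp_all only: minor_transpose[of M] add_2_eq_Suc'\<close>)
    then show ?case
      by (simp add: minor_transpose[of M])
  qed
  then show ?thesis
    unfolding strictly_totally_positive_def
    by (metis Suc_le_D One_nat_def)
qed

section \<open>Positive definiteness of products of factorial Hankel matrices\<close>

lemma det_pos_of_positive_definite:
  fixes A :: "nat \<Rightarrow> nat \<Rightarrow> real"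
  assumes pd: "\<And>v. \<exists>a<n. v a \<noteq> 0 \<Longrightarrow> (\<Sum>a<n. \<Sum>b<n. v a * A a b * v b) > 0"
  shows "det (mat n n (\<lambda>(a, b). A a b)) > 0"
proof -
  \<comment> \<open>The segment from the identity to \<open>A\<close> consists of positive definite, hence regular, matrices.\<close>
  define B where "B t = mat n n (\<lambda>(a, b). t * A a b + (1 - t) * (if a = b then 1 else 0))" for t
  have nonzero: "det (B t) \<noteq> 0" if t: "0 \<le> t" "t \<le> 1" for t
  proof
    assume "det (B t) = 0"
    then obtain w where w: "w \<in> carrier_vec n" "w \<noteq> 0\<^sub>v n" "B t *\<^sub>v w = 0\<^sub>v n"
      using det_0_iff_vec_prod_zero[of "B t" n] by (auto simp: B_def)
    define v where "v a = w $ a" for a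
    obtain c where c: "c < n" "v c \<noteq> 0"
      using w(1,2) by (auto simp: vec_eq_iff v_def)
    have "(\<Sum>b<n. (t * A a b + (1 - t) * (if a = b then 1 else 0)) * v b) = 0" if "a < n" for a
      using arg_cong[OF w(3), of "\<lambda>u. u $ a"] that w(1)
      by (simp add: B_def scalar_prod_def v_def atLeast0LessThan)
    \<comment> \<open>Pairing \<open>B t\<close> times \<open>v\<close> with \<open>v\<close> gives
      a convex combination of the quadratic form of \<open>A\<close> and the squared norm, both
      positive at \<open>v\<close>.\<close>
    then have "0 = (\<Sum>a<n. v a * (\<Sum>b<n. (t * A a b + (1 - t) * (if a = b then 1 else 0)) * v b))"
      by simp
    also have "\<dots> = (\<Sum>a<n. v a * (t * (\<Sum>b<n. A a b * v b) + (1 - t) * v a))"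
    proof (intro sum.cong refl)
      fix a assume "a \<in> {..<n}"
      moreover have "(1 - t) * (if a = b then 1 else 0) * v b = (if a = b then (1 - t) * v b else 0)" for b
        by simp
      ultimately show "v a * (\<Sum>b<n. (t * A a b + (1 - t) * (if a = b then 1 else 0)) * v b)
          = v a * (t * (\<Sum>b<n. A a b * v b) + (1 - t) * v a)"
        by (simp only: distrib_right sum.distrib) (simp add: sum_distrib_left mult.assoc)
    qed
    also have "\<dots> = (\<Sum>a<n. t * (\<Sum>b<n. v a * A a b * v b) + (1 - t) * (v a)\<^sup>2)"
      by (simp add: distrib_left sum_distrib_left power2_eq_square mult_ac)
    also have "\<dots> = t * (\<Sum>a<n. \<Sum>b<n. v a * A a b * v b) + (1 - t) * (\<Sum>a<n. (v a)\<^sup>2)"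
      by (simp add: sum.distrib sum_distrib_left)
    finally have "t * (\<Sum>a<n. \<Sum>b<n. v a * A a b * v b) + (1 - t) * (\<Sum>a<n. (v a)\<^sup>2) = 0" ..
    moreover have "(\<Sum>a<n. \<Sum>b<n. v a * A a b * v b) > 0"
      using c by (intro pd) auto
    moreover have "(\<Sum>a<n. (v a)\<^sup>2) > 0"
      using c by (intro sum_pos2[of _ c]) auto
    ultimately show False
      using t by (smt (verit) mult_nonneg_nonneg mult_pos_pos)
  qed
  have cont: "continuous_on {0..1} (\<lambda>t. det (B t))"
  proof -
    have "det (B t) = (\<Sum>p\<in>{p. p permutes {0..<n}}. signof p *
        (\<Prod>a = 0..<n. t * A a (p a) + (1 - t) * (if a = p a then 1 else 0)))" for t
      unfolding B_def det_def
      by (auto simp: permutes_in_image intro!: sum.cong prod.cong)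
    then show ?thesis
      by (auto intro!: continuous_intros)
  qed
  have "B 0 = 1\<^sub>m n"
    by (rule eq_matI) (auto simp: B_def)
  then have "det (B 0) = 1"
    by simp
  \<comment> \<open>A change of sign along the segment would force a zero by the intermediate value
    theorem.\<close>
  then have "det (B 1) > 0"
    using IVT2'[of "\<lambda>t. det (B t)" 1 0 0] cont nonzero by force
  then show ?thesis
    by (simp add: B_def)
qed

text \<open>Vandermonde applied to \<open>(p + (m + q)) choose q\<close>; the summands become
  symmetric in \<open>p\<close> and \<open>q\<close> since
  \<open>fact q * ((m + q) choose (q - l))\<close> equals
  \<open>fact l * (q choose l) * fact (m + q) / fact (m + l)\<close> for
  \<open>l \<le> q\<close>.\<close>

lemma fact_add_add_decomposition:
  assumes "p < r" "q < r"
  shows "(fact (m + p + q) :: real)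
    = (\<Sum>l<r. fact l / fact (m + l) * (fact (m + p) * real (p choose l)) * (fact (m + q) * real (q choose l)))"
proof -
  have "(fact (m + p + q) :: real) = fact (m + p) * fact q * real ((p + (m + q)) choose q)"
    by (simp add: binomial_fact add_ac)
  also have "(p + (m + q)) choose q = (\<Sum>l\<le>q. (p choose l) * ((m + q) choose (q - l)))"
    by (rule vandermonde[symmetric])
  also have "fact (m + p) * fact q * real \<dots>
     = (\<Sum>l\<le>q. fact l / fact (m + l) * (fact (m + p) * real (p choose l)) * (fact (m + q) * real (q choose l)))"
    unfolding of_nat_sum sum_distrib_left
    by (intro sum.cong refl) (auto simp: binomial_fact field_simps)
  \<comment> \<open>The added terms vanish because \<open>q choose l = 0\<close> for
    \<open>l > q\<close>.\<close>
  also have "\<dots> = (\<Sum>l<r. fact l / fact (m + l) * (fact (m + p) * real (p choose l)) * (fact (m + q) * real (q choose l)))"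
    by (rule sum.mono_neutral_left) (use assms in auto)
  finally show ?thesis .
qed

lemma fact_product_positive_definite:
  assumes "\<exists>a<r. v a \<noteq> 0"
  shows "(\<Sum>p<r. \<Sum>q<r. v p * (fact (m + p + q) * fact (m' + p + q)) * v q) > (0 :: real)"
proof -
  define d :: "nat \<Rightarrow> nat \<Rightarrow> real" where "d m l = fact l / fact (m + l)" for m l
  define B :: "nat \<Rightarrow> nat \<Rightarrow> nat \<Rightarrow> real" where "B m p l = fact (m + p) * real (p choose l)" for m p l
  define s where "s l l' = (\<Sum>p<r. v p * B m p l * B m' p l')" for l l'
  have d: "d m l > 0" for m l by (simp add: d_def)
  have fact_eq: "fact (m + p + q) = (\<Sum>l<r. d m l * B m p l * B m q l)" if "p < r" "q < r" for m p q
    using fact_add_add_decomposition[OF that] by (simp add: d_def B_def)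
  have term_eq: "v p * (fact (m + p + q) * fact (m' + p + q)) * v q
      = (\<Sum>l<r. \<Sum>l'<r. d m l * d m' l' * ((v p * B m p l * B m' p l') * (v q * B m q l * B m' q l')))"
    if "p < r" "q < r" for p q
    unfolding fact_eq[OF that] sum_product
    unfolding sum_distrib_left sum_distrib_right
    by (intro sum.cong refl) (simp add: mult_ac)
  have "(\<Sum>p<r. \<Sum>q<r. v p * (fact (m + p + q) * fact (m' + p + q)) * v q)
      = (\<Sum>p<r. \<Sum>q<r. \<Sum>l<r. \<Sum>l'<r. d m l * d m' l' * ((v p * B m p l * B m' p l') * (v q * B m q l * B m' q l')))"
    by (intro sum.cong refl) (simp add: term_eq)
  \<comment> \<open>With \<open>l\<close> and \<open>l'\<close> outermost, the inner double sum over
    \<open>p\<close> and \<open>q\<close> is a weighted square, as in Schur's product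
    theorem.\<close>
  also have "\<dots> = (\<Sum>p<r. \<Sum>l<r. \<Sum>l'<r. \<Sum>q<r. d m l * d m' l' * ((v p * B m p l * B m' p l') * (v q * B m q l * B m' q l')))"
    by (rule sum.cong[OF refl], subst sum.swap, rule sum.cong[OF refl], rule sum.swap)
  also have "\<dots> = (\<Sum>l<r. \<Sum>l'<r. \<Sum>p<r. \<Sum>q<r. d m l * d m' l' * ((v p * B m p l * B m' p l') * (v q * B m q l * B m' q l')))"
    by (subst sum.swap, rule sum.cong[OF refl], rule sum.swap)
  also have "\<dots> = (\<Sum>l<r. \<Sum>l'<r. d m l * d m' l' * (s l l')\<^sup>2)"
    unfolding s_def power2_eq_square sum_product
    unfolding sum_distrib_left ..
  also have "\<dots> > 0"
  proof -
    \<comment> \<open>By triangularity only the term \<open>p = c\<close> survives in \<open>s c c\<close>.\<close>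
    define c where "c = Max {a. a < r \<and> v a \<noteq> 0}"
    have c: "c < r" "v c \<noteq> 0"
      using Max_in[of "{a. a < r \<and> v a \<noteq> 0}"] assms unfolding c_def by auto
    have above: "v a = 0" if "a < r" "c < a" for a
      using Max_ge[of "{a. a < r \<and> v a \<noteq> 0}" a] that unfolding c_def by fastforce
    have "s c c = (\<Sum>p\<in>{c}. v p * B m p c * B m' p c)"
      unfolding s_def
    proof (rule sum.mono_neutral_right)
      show "\<forall>p\<in>{..<r} - {c}. v p * B m p c * B m' p c = 0"
      proof
        fix p assume "p \<in> {..<r} - {c}"
        then show "v p * B m p c * B m' p c = 0"
          using above[of p] by (cases "p < c") (auto simp: B_def)
      qed
    qed (use c in auto)
    then have "s c c \<noteq> 0"
      using c by (simp add: B_def)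
    then have "d m c * d m' c * (s c c)\<^sup>2 > 0"
      using d by simp
    then have "(\<Sum>l'<r. d m c * d m' l' * (s c l')\<^sup>2) > 0"
      by (intro sum_pos2[of _ c]) (use c d in \<open>auto simp: less_imp_le\<close>)
    then show ?thesis
      by (rule sum_pos2[of _ c, rotated 2]) (use c d in \<open>auto intro!: sum_nonneg simp: less_imp_le\<close>)
  qed
  finally show ?thesis .
qed

text \<open>A contiguous block of a Hankel matrix is again Hankel, here with offsets
  \<open>m + k\<close> and \<open>m + k + c\<close>.\<close>

lemma strictly_totally_positive_fact_product:
  "strictly_totally_positive (\<lambda>n k. fact (n + k) * fact (n + k + c))"
proof (rule strictly_totally_positive_of_contiguous_minors)
  fix r m k :: nat
  have "det (mat (Suc r) (Suc r) (\<lambda>(p, q). fact (m + k + p + q) * fact (m + k + c + p + q) :: real)) > 0"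
    by (intro det_pos_of_positive_definite fact_product_positive_definite)
  then show "minor (\<lambda>n k. fact (n + k) * fact (n + k + c)) (Suc r) (\<lambda>a. m + a) (\<lambda>a. k + a) > 0"
    unfolding minor_def by (simp add: add_ac)
qed

section \<open>Reduction of the Narayana matrices to factorial Hankel matrices\<close>

lemma NA_square_eq:
  "NA_square n k = 1 / (fact n * fact (n + 1)) * (fact (n + k) * fact (n + k + 1)) * (1 / ((real k + 1) * (fact k)\<^sup>2))"
  unfolding NA_square_def NA_def
  by (simp add: binomial_fact Suc_diff_le field_simps power2_eq_square del: fact_Suc of_nat_Suc)

text \<open>The summand \<open>0\<close> exhibits the middle factor as the case \<open>c = 0\<close>
  of the Hankel product.\<close>

lemma NB_square_eq:
  "NB_square n k = 1 / (fact n)\<^sup>2 * (fact (n + k) * fact (n + k + 0)) * (1 / (fact k)\<^sup>2)"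
  unfolding NB_square_def NB_def
  by (simp add: binomial_fact field_simps power2_eq_square)

theorem theorem3p2:
  shows "strictly_totally_positive NA_square \<and> strictly_totally_positive NB_square"
proof
  show "strictly_totally_positive NA_square"
    unfolding NA_square_eq[abs_def]
    by (intro strictly_totally_positive_scale strictly_totally_positive_fact_product) (auto simp: add_pos_pos)
  show "strictly_totally_positive NB_square"
    unfolding NB_square_eq[abs_def]
    by (intro strictly_totally_positive_scale strictly_totally_positive_fact_product) auto
qed

end
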